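(* Let $n \geq 1$ be an integer with prime factorisation $n=\prod_{i=1}^m \varphi_i^{a_i}$ ($\varphi_1,\dots,\varphi_m$ distinct primes, $a_i\ge 1$), and let $x>1$ be an integer. Let $\omega_n$ be the number of distinct prime factors of $x^n-1$. Then $$x \;\geq\; \min\left[\,\max\left\{\left(1+\prod_{j=0}^{t}\prod_{i=1}^{k_j} r_{i,j}\right)^{T(t)} \;\middle|\; t\in\{0,1,\dots,m\}\right\} \;\middle|\; (k_0,\dots,k_m)\in\mathbb{Z}_{\ge 0}^{m+1},\ \sum_{s=0}^m k_s=\omega_n\right],$$ where in the minimum only tuples with $k_j\le|\Pi_n^j|$ for all $j$ are admitted (so that every $r_{i,j}$ occurring is defined).
   Context: Set $\varphi_0:=1$. For $j\in\{0,1,\dots,m\}$ let $\Pi_n^j$ be the set of primes $\rho$ with $\rho\equiv 1 \pmod{\varphi_j}$ and $\rho\not\equiv 1\pmod{\varphi_i}$ for every $i$ with $j<i\le m$ (for $j=0$ the first condition is vacuous). These sets partition the set of all primes. Let $r_{i,j}$ denote the $i$-th smallest element of $\Pi_n^j$. Let $T(t)=\prod_{k=1}^{t}\varphi_k^{-a_k}$ (so $T(0)=1$ and $T(m)=1/n$). Empty products equal $1$. *)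

theory Defs
  imports
    Complex_Main
    "HOL-Library.FuncSet"
    "HOL-Library.Infinite_Set"
    "HOL-Number_Theory.Number_Theory"
begin

text \<open>The update \<open>\<phi>(0 := 1)\<close> implements the convention \<open>\<phi>\<^sub>0 = 1\<close>; only
  \<open>\<phi> 1, \<dots>, \<phi> m\<close> carry information.\<close>

definition prime_class :: "(nat \<Rightarrow> nat) \<Rightarrow> nat \<Rightarrow> nat \<Rightarrow> nat set" where
  "prime_class \<phi> m j =
     {\<rho>. prime \<rho> \<and> [\<rho> = 1] (mod (\<phi>(0 := 1)) j) \<and>
          (\<forall>i. j < i \<and> i \<le> m \<longrightarrow> \<not> [\<rho> = 1] (mod \<phi> i))}"

text \<open>The \<open>i\<close>-th smallest element, counted from \<open>i = 1\<close>; \<open>enumerate\<close> counts from \<open>0\<close>.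
  For a finite class the value is meaningful only for \<open>i\<close> up to its cardinality.\<close>

definition class_prime :: "(nat \<Rightarrow> nat) \<Rightarrow> nat \<Rightarrow> nat \<Rightarrow> nat \<Rightarrow> nat" where
  "class_prime \<phi> m i j = enumerate (prime_class \<phi> m j) (i - 1)"

definition T :: "(nat \<Rightarrow> nat) \<Rightarrow> (nat \<Rightarrow> nat) \<Rightarrow> nat \<Rightarrow> real" where
  "T \<phi> a t = (\<Prod>k=1..t. real (\<phi> k) powi (- int (a k)))"

text \<open>Tuples \<open>(k\<^sub>0, \<dots>, k\<^sub>m)\<close> are extensional functions on \<open>{0..m}\<close>, so the set below is
  finite. As \<open>card\<close> of an infinite set is \<open>0\<close>, the bound is imposed on finite classes only.\<close>

definition admissible_tuples :: "(nat \<Rightarrow> nat) \<Rightarrow> nat \<Rightarrow> nat \<Rightarrow> (nat \<Rightarrow> nat) set" where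
  "admissible_tuples \<phi> m w =
     {k \<in> {0..m} \<rightarrow>\<^sub>E UNIV. (\<Sum>s=0..m. k s) = w \<and>
        (\<forall>j\<in>{0..m}. finite (prime_class \<phi> m j) \<longrightarrow> k j \<le> card (prime_class \<phi> m j))}"

end

theory Submission
  imports Defs
begin

text \<open>For \<open>t \<le> m\<close> put \<open>N = \<Prod>i\<le>t. \<phi> i ^ a i\<close>. If a prime \<open>p\<close> dividing \<open>x ^ n - 1\<close> lies in one
  of the classes \<open>0, \<dots>, t\<close>, then the order of \<open>x\<close> modulo \<open>p\<close> divides both \<open>n\<close> and \<open>p - 1\<close>, and the
  latter is divisible by none of \<open>\<phi> (t + 1), \<dots>, \<phi> m\<close>; so the order divides \<open>N\<close>, i.e.
  \<open>p\<close> divides \<open>x ^ N - 1\<close>. The product of all these primes is therefore less than \<open>x ^ N\<close>, and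
  replacing the primes of each class by the smallest ones of that class only decreases it. Hence
  the tuple counting the prime factors of \<open>x ^ n - 1\<close> class by class has maximum at most \<open>x\<close>.\<close>

text \<open>Induction on \<open>card A\<close>, splitting off the minimum of \<open>A\<close> and of
  \<open>S\<close> together: \<open>Min A\<close> is at least the least element \<open>l\<close> of
  \<open>S\<close>, and every other element of \<open>A\<close> exceeds \<open>l\<close>, so the
  hypothesis applies to \<open>A - {b}\<close> inside \<open>S - {l}\<close>.\<close>

lemma prod_enumerate_le_prod:
  fixes A S :: "nat set"
  assumes "finite A" "A \<subseteq> S"
  shows "(\<Prod>i<card A. enumerate S i) \<le> \<Prod>A"
  using assms
proof (induction "card A" arbitrary: A S)
  case 0
  then show ?case by simp
next
  case (Suc c)
  define l where "l = (LEAST s. s \<in> S)"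
  define b where "b = Min A"
  have ne: "A \<noteq> {}" using Suc.hyps(2) by auto
  have b: "b \<in> A" using ne Suc.prems by (simp add: b_def)
  have lb: "l \<le> b" unfolding l_def using b Suc.prems by (intro Least_le) auto
  have "A - {b} \<subseteq> S - {l}"
  proof
    fix y assume y: "y \<in> A - {b}"
    then have "b < y" using Suc.prems(1) by (simp add: b_def order.not_eq_order_implies_strict)
    with y lb Suc.prems show "y \<in> S - {l}" by auto
  qed
  moreover have c: "c = card (A - {b})" using Suc b by simp
  ultimately have IH: "(\<Prod>i<c. enumerate (S - {l}) i) \<le> \<Prod>(A - {b})"
    using Suc.hyps(1)[of "A - {b}" "S - {l}"] Suc.prems by simp
  have "(\<Prod>i<card A. enumerate S i) = enumerate S 0 * (\<Prod>i<c. enumerate S (Suc i))"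
    by (simp only: Suc.hyps(2)[symmetric] prod.lessThan_Suc_shift)
  also have "\<dots> = l * (\<Prod>i<c. enumerate (S - {l}) i)"
    by (simp add: l_def enumerate_0 enumerate_Suc)
  also have "\<dots> \<le> b * \<Prod>(A - {b})" using lb IH by (rule mult_le_mono)
  also have "\<dots> = \<Prod>A" using b Suc.prems by (simp add: prod.remove)
  finally show ?case .
qed

lemma prod_distinct_primes_dvd:
  fixes M :: nat
  assumes "finite A" "\<And>p. p \<in> A \<Longrightarrow> prime p" "\<And>p. p \<in> A \<Longrightarrow> p dvd M"
  shows "\<Prod>A dvd M"
  using assms
proof (induction A)
  case (insert p A)
  have "coprime p (\<Prod>A)"
    using insert by (intro prod_coprime_right) (metis insertCI primes_coprime)
  then show ?case using insert by (simp add: divides_mult)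
qed auto

lemma prime_dvd_power_diff_coprime_cofactor:
  fixes p x N R :: nat
  assumes "prime p" "p dvd x ^ (N * R) - 1" "x > 1" "N * R \<ge> 1" "coprime R (p - 1)"
  shows "p dvd x ^ N - 1"
proof -
  \<comment> \<open>Since \<open>x ^ e\<close> is at least 1, the subtraction on naturals does not
    truncate.\<close>
  have pow: "[x ^ e = 1] (mod p) \<longleftrightarrow> p dvd x ^ e - 1" for e
    using assms(3) by (intro cong_altdef_nat) simp
  have "[x ^ (N * R) = 1] (mod p)" using assms(2) pow by simp
  then have ord: "ord p x dvd N * R" by (metis ord_divides)
  have "coprime p x"
  proof -
    have "coprime (x ^ (N * R)) p"
      using \<open>[x ^ (N * R) = 1] (mod p)\<close> by (meson cong_imp_coprime cong_sym coprime_1_left)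
    then show ?thesis using assms(4) by (simp add: coprime_commute)
  qed
  then have "ord p x dvd totient p" by (intro order_divides_totient)
  then have "ord p x dvd p - 1" using assms(1) by (simp add: totient_prime)
  then have "coprime (ord p x) R"
    using assms(5) by (metis coprime_commute coprime_divisors dvd_refl)
  with ord have "ord p x dvd N" by (simp add: coprime_dvd_mult_left_iff)
  then show ?thesis using pow by (metis ord_divides)
qed

text \<open>The class with the larger index demands the very congruence that the other one
  forbids.\<close>

lemma prime_class_disjoint:
  assumes "i \<noteq> j" "i \<le> m" "j \<le> m"
  shows "prime_class \<phi> m i \<inter> prime_class \<phi> m j = {}"
proof -
  have "prime_class \<phi> m i \<inter> prime_class \<phi> m j = {}" if "i < j" "j \<le> m" for i j
    using that by (auto simp: prime_class_def)
  with assms show ?thesis by (metis Int_commute nat_neq_iff)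
qed

text \<open>The class of \<open>p\<close> is given by the largest index \<open>j\<close> with
  \<open>p\<close> congruent to 1 modulo \<open>\<phi> j\<close>; index 0 always qualifies, its
  modulus being 1.\<close>

lemma prime_class_cover:
  assumes "prime p"
  shows "\<exists>j\<le>m. p \<in> prime_class \<phi> m j"
proof -
  define J where "J = {j. j \<le> m \<and> [p = 1] (mod (\<phi>(0 := 1)) j)}"
  have fin: "finite J" by (simp add: J_def)
  have "0 \<in> J" by (simp add: J_def)
  then obtain j where j: "j \<in> J" "\<And>i. i \<in> J \<Longrightarrow> i \<le> j"
    using fin by (metis Max_in Max_ge empty_iff)
  have "\<not> [p = 1] (mod \<phi> i)" if "j < i" "i \<le> m" for i
  proof
    assume "[p = 1] (mod \<phi> i)"
    then have "i \<in> J" using that by (simp add: J_def)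
    then show False using j(2) that(1) by fastforce
  qed
  with j(1) assms show ?thesis by (auto simp: J_def prime_class_def simp del: fun_upd_apply)
qed

text \<open>Makes \<open>Min\<close> a genuine minimum: each entry is at most the total
  \<open>w\<close>.\<close>

lemma finite_admissible_tuples: "finite (admissible_tuples \<phi> m w)"
proof (rule finite_subset)
  show "admissible_tuples \<phi> m w \<subseteq> {0..m} \<rightarrow>\<^sub>E {..w}"
  proof
    fix k assume k: "k \<in> admissible_tuples \<phi> m w"
    then have "k s \<le> w" if "s \<in> {0..m}" for s
      using member_le_sum[of s "{0..m}" k] that by (auto simp: admissible_tuples_def)
    with k show "k \<in> {0..m} \<rightarrow>\<^sub>E {..w}"
      by (auto simp: admissible_tuples_def PiE_iff)
  qed
qed (simp add: finite_PiE)

theorem theorem1p1: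
  fixes n m x :: nat and \<phi> a :: "nat \<Rightarrow> nat"
  assumes "n \<ge> 1"
    and "n = (\<Prod>i=1..m. \<phi> i ^ a i)"
    and "\<And>i. i \<in> {1..m} \<Longrightarrow> prime (\<phi> i)"
    and "inj_on \<phi> {1..m}"
    and "\<And>i. i \<in> {1..m} \<Longrightarrow> a i \<ge> 1"
    and "x > 1"
  shows "real x \<ge>
    Min {Max {(1 + (\<Prod>j=0..t. \<Prod>i=1..k j. real (class_prime \<phi> m i j))) powr T \<phi> a t
              | t. t \<in> {0..m}}
        | k. k \<in> admissible_tuples \<phi> m (card (prime_factors (x ^ n - 1)))}"
proof -
  define P where "P = prime_factors (x ^ n - 1)"
  define F where "F k t = (1 + (\<Prod>j=0..t. \<Prod>i=1..k j. real (class_prime \<phi> m i j))) powr T \<phi> a t"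
    for k :: "nat \<Rightarrow> nat" and t
  define C where "C j = P \<inter> prime_class \<phi> m j" for j
  \<comment> \<open>Restricted to \<open>{0..m}\<close> because admissible tuples are
    extensional.\<close>
  define k where "k = restrict (\<lambda>j. card (C j)) {0..m}"
  have finC: "finite (C j)" for j by (simp add: C_def P_def)
  have disj: "\<forall>i\<in>{0..t}. \<forall>j\<in>{0..t}. i \<noteq> j \<longrightarrow> C i \<inter> C j = {}" if "t \<le> m" for t
    using prime_class_disjoint[of _ _ m \<phi>] that by (fastforce simp: C_def)

  have "P = (\<Union>j\<in>{0..m}. C j)"
  proof -
    have "p \<in> (\<Union>j\<in>{0..m}. C j)" if "p \<in> P" for p
    proof -
      have "prime p" using that by (auto simp: P_def)
      from prime_class_cover[OF this, of m \<phi>] that show ?thesis by (auto simp: C_def)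
    qed
    then show ?thesis by (auto simp: C_def)
  qed
  then have "card P = (\<Sum>j\<in>{0..m}. k j)"
    using card_UN_disjoint[of "{0..m}" C] finC disj[of m] by (simp add: k_def)
  moreover have "k j \<le> card (prime_class \<phi> m j)"
    if "j \<in> {0..m}" "finite (prime_class \<phi> m j)" for j
    using that by (auto simp: k_def C_def intro: card_mono)
  ultimately have kadm: "k \<in> admissible_tuples \<phi> m (card P)"
    by (auto simp: admissible_tuples_def k_def)

  have bound: "F k t \<le> real x" if t: "t \<le> m" for t
  proof -
    define N where "N = (\<Prod>i=1..t. \<phi> i ^ a i)"
    define R where "R = (\<Prod>i=Suc t..m. \<phi> i ^ a i)"
    have NR: "n = N * R"
      unfolding assms(2) N_def R_def using prod.ub_add_nat[of 1 t _ "m - t"] t by simp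
    have N: "N > 0" using NR assms(1) by (cases N) auto
    \<comment> \<open>The exponent \<open>T \<phi> a t\<close> thus takes an \<open>N\<close>-th
      root, so it suffices to bound the base by \<open>x ^ N\<close>.\<close>
    have T: "T \<phi> a t = 1 / real N"
      by (simp add: T_def N_def power_int_minus prod_inversef[unfolded o_def] divide_inverse)
    have dvd: "p dvd x ^ N - 1" if p: "p \<in> C j" and j: "j \<le> t" for p j
    proof (rule prime_dvd_power_diff_coprime_cofactor)
      show pp: "prime p" "p dvd x ^ (N * R) - 1"
        using p by (auto simp: C_def P_def NR)
      show "coprime R (p - 1)"
        unfolding R_def
      proof (rule prod_coprime_left)
        fix i assume i: "i \<in> {Suc t..m}"
        \<comment> \<open>Here \<open>j \<le> t < i\<close>, so class \<open>j\<close> excludes this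
          congruence.\<close>
        then have "\<not> [p = 1] (mod \<phi> i)" using p j by (auto simp: C_def prime_class_def)
        then have "\<not> \<phi> i dvd p - 1"
          using pp(1) cong_altdef_nat prime_ge_1_nat by blast
        moreover have "prime (\<phi> i)" using i assms(3) by auto
        ultimately show "coprime (\<phi> i ^ a i) (p - 1)"
          by (simp add: prime_imp_coprime)
      qed
    qed (use assms(1,6) NR in auto)
    define U where "U = (\<Union>j\<in>{0..t}. C j)"
    have "\<Prod>U dvd x ^ N - 1"
      using dvd by (intro prod_distinct_primes_dvd) (auto simp: U_def finC C_def P_def)
    moreover have "x ^ N > 1" using assms(6) N by (intro one_less_power)
    \<comment> \<open>As \<open>x ^ N - 1\<close> is positive, its divisor \<open>\<Prod>U\<close>
      is at most \<open>x ^ N - 1\<close>; this gap of one absorbs the summand 1 in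
      \<open>F\<close>.\<close>
    ultimately have U: "\<Prod>U < x ^ N" by (auto dest!: dvd_imp_le)
    have le_C: "(\<Prod>i=1..k j. class_prime \<phi> m i j) \<le> \<Prod>(C j)" if "j \<le> t" for j
    proof -
      \<comment> \<open>The shift \<open>i - 1\<close> in \<open>class_prime\<close> turns the range
        \<open>1..k j\<close> into indices below \<open>card (C j)\<close>.\<close>
      have "(\<Prod>i=1..k j. class_prime \<phi> m i j) = (\<Prod>i<card (C j). enumerate (prime_class \<phi> m j) i)"
        using that t
        by (simp add: k_def class_prime_def prod.atLeast1_atMost_eq)
      also have "\<dots> \<le> \<Prod>(C j)"
        by (rule prod_enumerate_le_prod) (simp_all add: finC, simp add: C_def)
      finally show ?thesis .
    qed
    have "(\<Prod>j=0..t. \<Prod>i=1..k j. class_prime \<phi> m i j) \<le> (\<Prod>j=0..t. \<Prod>(C j))"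
      using le_C by (intro prod_mono) auto
    also have "\<dots> = \<Prod>U"
      unfolding U_def using finC disj[OF t] by (simp add: prod.UNION_disjoint)
    finally have "1 + (\<Prod>j=0..t. \<Prod>i=1..k j. class_prime \<phi> m i j) \<le> x ^ N" using U by simp
    then have "real (1 + (\<Prod>j=0..t. \<Prod>i=1..k j. class_prime \<phi> m i j)) \<le> real (x ^ N)"
      by (simp only: of_nat_le_iff)
    then have "1 + (\<Prod>j=0..t. \<Prod>i=1..k j. real (class_prime \<phi> m i j)) \<le> real x ^ N" by simp
    then have "F k t \<le> (real x ^ N) powr (1 / real N)"
      unfolding F_def T by (intro powr_mono2) (auto intro!: add_nonneg_nonneg prod_nonneg)
    also have "\<dots> = real x"
      using assms(6) N by (simp add: powr_realpow[symmetric] powr_powr)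
    finally show ?thesis .
  qed

  have "Min {Max {F k t | t. t \<in> {0..m}} | k. k \<in> admissible_tuples \<phi> m (card P)}
      \<le> Max {F k t | t. t \<in> {0..m}}"
    using kadm finite_admissible_tuples[of \<phi> m "card P"] by (intro Min_le) auto
  also have "\<dots> \<le> real x"
    using bound by (subst Max_le_iff) auto
  finally show ?thesis unfolding F_def P_def .
qed

end
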